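(* Let $\mathbf H$ be either $\mathbf Z$ or $\mathbf N$, and let $F:\mathbf Z\to\mathbf Z$ be a polynomial function with coefficients in $\mathbf H$. Then $F(\mathbf H)$ is small if and only if $\deg F\ne1$.
   Context: $\mathbf N=\{0,1,2,\dots\}$, $\mathbf N^+=\mathbf N\setminus\{0\}$. For $X\subseteq\mathbf H$, $k\in\mathbf N^+$, $h\in\mathbf N$ write $k\cdot X+h:=\{kx+h:x\in X\}$. An upper quasi-density on $\mathbf H$ is a function $\mu^\ast:\mathcal P(\mathbf H)\to\mathbf R$ such that for all $X,Y\subseteq\mathbf H$, $k\in\mathbf N^+$, $h\in\mathbf N$: $\mu^\ast(X)\le 1$, $\mu^\ast(\mathbf H)=1$, $\mu^\ast(X\cup Y)\le\mu^\ast(X)+\mu^\ast(Y)$, $\mu^\ast(k\cdot X)=\frac1k\mu^\ast(X)$, and $\mu^\ast(X+h)=\mu^\ast(X)$. A set $X\subseteq\mathbf H$ is small if $\mu^\ast(X)=0$ for every upper quasi-density $\mu^\ast$ on $\mathbf H$. *)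

theory Defs
  imports Complex_Main "HOL-Computational_Algebra.Polynomial"
begin

(* Functions on the power set of H are represented by functions on all sets of
   integers; the axioms constrain the values on subsets of H only.
   Monotonicity is not among the axioms. *)
definition upper_quasi_density :: "int set \<Rightarrow> (int set \<Rightarrow> real) \<Rightarrow> bool" where
  "upper_quasi_density H \<mu> \<longleftrightarrow>
     (\<forall>X. X \<subseteq> H \<longrightarrow> \<mu> X \<le> 1) \<and>
     \<mu> H = 1 \<and>
     (\<forall>X Y. X \<subseteq> H \<longrightarrow> Y \<subseteq> H \<longrightarrow> \<mu> (X \<union> Y) \<le> \<mu> X + \<mu> Y) \<and>
     (\<forall>X (k::nat). X \<subseteq> H \<longrightarrow> k \<ge> 1 \<longrightarrow> \<mu> {int k * x | x. x \<in> X} = 1 / real k * \<mu> X) \<and>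
     (\<forall>X (h::nat). X \<subseteq> H \<longrightarrow> \<mu> {x + int h | x. x \<in> X} = \<mu> X)"

definition small_set :: "int set \<Rightarrow> int set \<Rightarrow> bool" where
  "small_set H X \<longleftrightarrow> X \<subseteq> H \<and> (\<forall>\<mu>. upper_quasi_density H \<mu> \<longrightarrow> \<mu> X = 0)"

end

theory Submission
  imports "HOL-Number_Theory.Number_Theory" Defs
begin

text \<open>
  Splitting a set into residue classes modulo \<open>k\<close> and applying the axioms class by class bounds its
  upper quasi-density by the proportion of residues it meets, so that monotonicity is not required.
  For a polynomial of degree \<open>d \<ge> 2\<close> this proportion can be made arbitrarily small: it is
  submultiplicative over coprime moduli, and it is at most \<open>1 - 1/(4d)\<close> at each of the infinitely
  many primes \<open>p \<equiv> 1 (mod d)\<close> not dividing the leading coefficient. The latter is a version of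
  Hermite's criterion for permutation polynomials: the sum over \<open>x mod p\<close> of \<open>g (f x)\<close> does not vanish
  for monic \<open>g\<close> of degree \<open>(p - 1)/d\<close>, whereas it would vanish for a \<open>g\<close> that kills the few values
  missed or repeated by \<open>f\<close>.
  In degree 1 the image is an arithmetic progression, which has positive upper asymptotic density.
\<close>

subsection \<open>Primes congruent to 1\<close>

lemma poly_map_of_int_mult:
  "poly (map_poly of_int (f * g)) z = poly (map_poly of_int f) z * poly (map_poly of_int g) (z :: 'a :: comm_ring_1)"
proof -
  have "map_poly of_int (f * g) = map_poly of_int f * (map_poly of_int g :: 'a poly)"
    by (intro poly_eqI) (simp add: coeff_map_poly coeff_mult)
  then show ?thesis by simp
qed

lemma poly_map_of_int_add:
  "poly (map_poly of_int (f + g)) z = poly (map_poly of_int f) z + poly (map_poly of_int g) (z :: 'a :: comm_ring_1)"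
proof -
  have "map_poly of_int (f + g) = map_poly of_int f + (map_poly of_int g :: 'a poly)"
    by (intro poly_eqI) (simp add: coeff_map_poly)
  then show ?thesis by simp
qed

lemma poly_map_of_int_monom_minus_1:
  "poly (map_poly of_int (monom 1 n - 1)) z = z ^ n - (1 :: 'a :: comm_ring_1)"
proof -
  have "map_poly of_int (monom 1 n - 1) = (monom 1 n - 1 :: 'a poly)"
    by (intro poly_eqI) (simp add: coeff_map_poly)
  then show ?thesis by (simp add: poly_monom)
qed

text \<open>The pseudo-remainder of \<open>f\<close> by \<open>C\<close> lies in \<open>I\<close>
  and, if nonzero, has smaller degree than \<open>C\<close>, so minimality forces it to
  vanish.\<close>

lemma min_degree_pseudo_dvd:
  fixes C f :: "'a :: idom poly"
  assumes "C \<noteq> 0"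
    and min: "\<And>g. g \<noteq> 0 \<Longrightarrow> g \<in> I \<Longrightarrow> degree C \<le> degree g"
    and I: "\<And>m q. smult m f - C * q \<in> I"
  obtains m q where "m \<noteq> 0" "smult m f = C * q"
proof -
  obtain m q where mq: "m \<noteq> 0" "smult m f = C * q + pseudo_mod f C"
    using pseudo_mod(1)[OF \<open>C \<noteq> 0\<close>, of f] by blast
  have "pseudo_mod f C \<in> I"
    using I[of m q] mq(2) by simp
  then have "pseudo_mod f C = 0"
    using min pseudo_mod(2)[OF \<open>C \<noteq> 0\<close>, of f] not_le by blast
  then show ?thesis using mq that by simp
qed

text \<open>
  An integer polynomial \<open>C\<close> of least degree among those annihilating \<open>z\<close> plays the role of the minimal
  polynomial over the rationals; pseudo-division replaces division.
\<close>

lemma integral_annihilator: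
  fixes z :: complex and f :: "int poly"
  assumes "f \<noteq> 0" "poly (map_poly of_int f) z = 0"
  obtains C where "C \<noteq> 0" "poly (map_poly of_int C) z = 0"
    "\<And>g. poly (map_poly of_int g) z = 0 \<Longrightarrow> \<exists>m q. m \<noteq> 0 \<and> smult m g = C * q"
    "\<And>g. poly (map_poly of_int g) z \<noteq> 0 \<Longrightarrow> \<exists>u v N. N \<noteq> 0 \<and> u * C + v * g = [:N:]"
proof -
  let ?ev = "\<lambda>g :: int poly. poly (map_poly of_int g) z"
  define I where "I = {g. ?ev g = 0}"
  have ev_smult: "?ev (smult m g) = of_int m * ?ev g" for m g
    using poly_map_of_int_mult[of "[:m:]" g z] by (simp add: map_poly_pCons)
  have ev_diff: "?ev (g - h) = ?ev g - ?ev h" for g h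
    using poly_map_of_int_add[of "g - h" h z] by simp
  obtain C where C: "C \<noteq> 0" "C \<in> I"
    and min: "\<And>g. g \<noteq> 0 \<Longrightarrow> g \<in> I \<Longrightarrow> degree C \<le> degree g"
    using ex_has_least_nat[of "\<lambda>g. g \<noteq> 0 \<and> g \<in> I" f degree] assms I_def by auto
  have evC: "?ev C = 0" using C I_def by simp
  have div: "\<exists>m q. m \<noteq> 0 \<and> smult m g = C * q" if "?ev g = 0" for g
  proof -
    have "smult m g - C * q \<in> I" for m q
      unfolding I_def using that evC by (simp add: ev_diff ev_smult poly_map_of_int_mult)
    then show ?thesis
      using min_degree_pseudo_dvd[OF C(1) min, where f = g] by blast
  qed
  have bez: "\<exists>u v N. N \<noteq> 0 \<and> u * C + v * g = [:N:]" if g: "?ev g \<noteq> 0" for g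
  proof -
    \<comment> \<open>An element \<open>D\<close> of least degree in the ideal \<open>J\<close>
      generated by \<open>C\<close> and \<open>g\<close> divides both up to constants. Since
      \<open>g\<close> does not vanish at \<open>z\<close>, neither does \<open>D\<close>, so the
      cofactor of \<open>D\<close> in \<open>C\<close> does; by minimality of \<open>C\<close> this
      leaves degree 0 for \<open>D\<close>.\<close>
    define J where "J = {u * C + v * g | u v. True}"
    have CJ: "C \<in> J" unfolding J_def by (rule CollectI, rule exI[of _ 1], rule exI[of _ 0]) simp
    have gJ: "g \<in> J" unfolding J_def by (rule CollectI, rule exI[of _ 0], rule exI[of _ 1]) simp
    have J: "smult m a - b * q \<in> J" if "a \<in> J" "b \<in> J" for m a b q
    proof -
      obtain u v u' v' where "a = u * C + v * g" "b = u' * C + v' * g"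
        using \<open>a \<in> J\<close> \<open>b \<in> J\<close> J_def by auto
      then have "smult m a - b * q = (smult m u - u' * q) * C + (smult m v - v' * q) * g"
        by (simp add: algebra_simps smult_add_right)
      then show ?thesis unfolding J_def by blast
    qed
    obtain D where D: "D \<noteq> 0" "D \<in> J"
      and minD: "\<And>h. h \<noteq> 0 \<Longrightarrow> h \<in> J \<Longrightarrow> degree D \<le> degree h"
      using ex_has_least_nat[of "\<lambda>h. h \<noteq> 0 \<and> h \<in> J" C degree] C CJ by auto
    obtain m q where mq: "m \<noteq> 0" "smult m g = D * q"
      using min_degree_pseudo_dvd[OF D(1) minD, where f = g] J[OF gJ D(2)] by blast
    have evD: "?ev D \<noteq> 0"
    proof
      assume "?ev D = 0"
      then have "of_int m * ?ev g = 0"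
        using mq(2) by (metis ev_smult poly_map_of_int_mult mult_zero_left)
      then show False using mq(1) g by simp
    qed
    obtain m' q' where mq': "m' \<noteq> 0" "smult m' C = D * q'"
      using min_degree_pseudo_dvd[OF D(1) minD, where f = C] J[OF CJ D(2)] by blast
    have "q' \<noteq> 0" using mq' C(1) by auto
    have "?ev D * ?ev q' = 0"
      using mq'(2) evC by (metis ev_smult poly_map_of_int_mult mult_zero_right)
    then have "q' \<in> I" using evD I_def by simp
    then have "degree C \<le> degree q'" using min \<open>q' \<noteq> 0\<close> by blast
    moreover have "degree C = degree D + degree q'"
      using mq' D(1) \<open>q' \<noteq> 0\<close> by (metis degree_mult_eq degree_smult_eq)
    ultimately have "degree D = 0" by simp
    then obtain N where "D = [:N:]" by (auto elim: degree_eq_zeroE)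
    moreover obtain u v where "D = u * C + v * g" using D(2) J_def by blast
    ultimately show ?thesis using D(1) by (metis pCons_0_0)
  qed
  show ?thesis using that[OF C(1) evC div bez] .
qed

text \<open>
  At arguments \<open>a\<close> divisible by \<open>C(0)\<^sup>2 T\<close>, the quotient \<open>C(a) / C(0)\<close> is congruent to 1 modulo \<open>T\<close>.
\<close>

lemma poly_prime_divisor:
  fixes C :: "int poly" and T :: nat
  assumes deg: "degree C > 0" and C0: "poly C 0 \<noteq> 0" and "T > 0"
  obtains p a :: nat where "prime p" "\<not> p dvd T" "int p dvd poly C (int a)"
proof -
  define c where "c = poly C 0"
  \<comment> \<open>Outside the finite set \<open>B\<close>, the cofactor of \<open>c\<close> in the
    value of \<open>C\<close> is none of 0, 1, -1 and hence has a prime factor.\<close>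
  define B where "B = {x. poly C x = 0} \<union> {x. poly (C - [:c:]) x = 0} \<union> {x. poly (C - [:-c:]) x = 0}"
  have nz: "C - [:e:] \<noteq> 0" for e
    using deg by auto
  have "finite B" unfolding B_def using nz nz[of 0] poly_roots_finite by (metis diff_zero finite_Un pCons_0_0)
  \<comment> \<open>One factor \<open>c\<close> is divided out of the value, \<open>T\<close> makes
    the cofactor 1 modulo \<open>T\<close>, and squaring \<open>c\<close> keeps the argument
    nonnegative, so that it is a natural number.\<close>
  define g where "g s = c * c * int T * int s" for s
  have "inj g" unfolding g_def inj_def using C0 \<open>T > 0\<close> c_def by simp
  then have "infinite (range g)" using infinite_UNIV_nat finite_imageD by blast
  then obtain s where s: "g s \<notin> B" using \<open>finite B\<close> by (meson finite_subset image_subset_iff)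
  obtain C' where C': "C = pCons c C'" using c_def by (metis pCons_cases poly_pCons add.right_neutral mult_zero_left)
  define w where "w = 1 + int T * (c * int s * poly C' (g s))"
  have "poly C (g s) = c * w"
    unfolding C' w_def by (simp add: g_def algebra_simps)
  moreover have "poly C (g s) \<noteq> 0" "poly C (g s) \<noteq> c" "poly C (g s) \<noteq> - c"
    using s unfolding B_def by auto
  ultimately have "w \<noteq> 0" "w \<noteq> 1" "w \<noteq> - 1" "w dvd poly C (g s)" by auto
  moreover from this have "\<not> is_unit w" by (auto simp: abs_if split: if_splits)
  ultimately obtain q where q: "prime q" "q dvd w" and w: "w dvd poly C (g s)"
    using prime_divisor_exists by blast
  obtain p where p: "q = int p" "prime p"
    using q(1) by (metis nat_0_le prime_ge_0_int prime_int_nat_transfer)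
  have "\<not> p dvd T"
  proof
    assume "p dvd T"
    then have "q dvd 1 + int T * (c * int s * poly C' (g s)) - int T * (c * int s * poly C' (g s))"
      using q(2) p(1) w_def by (intro dvd_diff) auto
    then show False using q(1) by auto
  qed
  moreover have "g s = int (nat (g s))" by (simp add: g_def)
  ultimately show ?thesis
    using that[of p "nat (g s)"] p q(2) w by (metis dvd_trans)
qed

text \<open>
  A prime dividing a value of the (essentially cyclotomic) annihilator of a primitive root of unity
  at \<open>a\<close>, but none of the denominators, is one modulo which \<open>a\<close> has order exactly \<open>n\<close>.
\<close>

lemma prime_cong_1:
  fixes n T :: nat
  assumes "n > 0" "T > 0"
  obtains p where "prime p" "[p = 1] (mod n)" "\<not> p dvd T"
proof -
  define z where "z = cis (2 * pi / real n)"
  define F where "F k = (monom 1 k - 1 :: int poly)" for k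
  \<comment> \<open>That \<open>L\<close> does not vanish at \<open>z\<close> expresses that the
    \<open>n\<close>-th root of unity \<open>z\<close> is primitive.\<close>
  define L where "L = (\<Prod>k\<in>{0<..<n}. F k)"
  let ?ev = "\<lambda>g :: int poly. poly (map_poly of_int g) z"
  have evF: "?ev (F k) = z ^ k - 1" for k
    unfolding F_def by (rule poly_map_of_int_monom_minus_1)
  have polyF: "poly (F k) x = x ^ k - 1" for k x
    by (simp add: F_def poly_monom)
  have "F n \<noteq> 0"
    using polyF[of n 0] \<open>n > 0\<close> by (auto simp: zero_power)
  have "z ^ n = 1" using \<open>n > 0\<close> by (simp add: z_def DeMoivre)
  then have evFn: "?ev (F n) = 0" by (simp add: evF)
  have zk: "z ^ k \<noteq> 1" if "0 < k" "k < n" for k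
  proof
    assume "z ^ k = 1"
    then have "cos (2 * pi * real k / real n) = 1"
      by (simp add: z_def DeMoivre complex_eq_iff mult_ac)
    then obtain j :: int where "2 * pi * real k / real n = real_of_int j * 2 * pi"
      using cos_one_2pi_int by blast
    then have "real k = real_of_int j * real n" using \<open>n > 0\<close> by (simp add: field_simps)
    then have "int k = j * int n" by (metis of_int_eq_iff of_int_mult of_int_of_nat_eq)
    then have "int n dvd int k" by simp
    then show False using that by (auto dest: dvd_imp_le)
  qed
  have "?ev (\<Prod>k\<in>A. F k) = (\<Prod>k\<in>A. z ^ k - 1)" for A
    by (induction A rule: infinite_finite_induct) (simp_all add: poly_map_of_int_mult evF)
  then have evL: "?ev L \<noteq> 0" unfolding L_def using zk by simp
  obtain C where C: "C \<noteq> 0" "?ev C = 0"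
    and div: "\<And>g. ?ev g = 0 \<Longrightarrow> \<exists>m q. m \<noteq> 0 \<and> smult m g = C * q"
    and bez: "\<And>g. ?ev g \<noteq> 0 \<Longrightarrow> \<exists>u v N. N \<noteq> 0 \<and> u * C + v * g = [:N:]"
    using integral_annihilator[OF \<open>F n \<noteq> 0\<close> evFn] by metis
  obtain M q where M: "M \<noteq> 0" "smult M (F n) = C * q" using div evFn by blast
  obtain u v N where N: "N \<noteq> 0" "u * C + v * L = [:N:]" using bez evL by blast
  have "degree C > 0"
  proof (rule ccontr)
    assume "\<not> degree C > 0"
    then have "degree C = 0" by simp
    then obtain e where "C = [:e:]" by (auto elim: degree_eq_zeroE)
    then show False using C by (auto simp: map_poly_pCons)
  qed
  moreover have "poly C 0 \<noteq> 0"
  proof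
    assume "poly C 0 = 0"
    then have "poly (smult M (F n)) 0 = 0" unfolding M(2) by simp
    then show False using M(1) \<open>n > 0\<close> by (simp add: polyF zero_power)
  qed
  \<comment> \<open>Avoiding \<open>M\<close> passes divisibility from \<open>C\<close> to
    \<open>F n\<close>; avoiding \<open>N\<close> keeps \<open>p\<close> from dividing the values of
    both \<open>C\<close> and \<open>L\<close>.\<close>
  moreover have "T * nat \<bar>M\<bar> * nat \<bar>N\<bar> > 0" using assms M(1) N(1) by simp
  ultimately obtain p a where pa: "prime p" "\<not> p dvd T * nat \<bar>M\<bar> * nat \<bar>N\<bar>" "int p dvd poly C (int a)"
    by (rule poly_prime_divisor)
  have pM: "\<not> int p dvd M" and pN: "\<not> int p dvd N" and pT: "\<not> p dvd T"
    using pa(2) by (auto simp: dvd_nat_abs_iff)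
  have ip: "prime (int p)" using pa(1) by simp
  have "int p dvd poly (smult M (F n)) (int a)" unfolding M(2) using pa(3) by simp
  then have an: "int p dvd int a ^ n - 1"
    using pM ip by (simp add: polyF prime_dvd_mult_iff)
  have ak: "\<not> int p dvd int a ^ k - 1" if "0 < k" "k < n" for k
  proof
    assume "int p dvd int a ^ k - 1"
    moreover have "F k dvd L" unfolding L_def using that by (intro dvd_prodI) auto
    ultimately have "int p dvd poly L (int a)"
      by (metis polyF dvd_def dvd_mult2 poly_mult)
    then have "int p dvd poly (u * C + v * L) (int a)" using pa(3) by simp
    then show False unfolding N(2) using pN by simp
  qed
  have cong: "[a ^ k = 1] (mod p) \<longleftrightarrow> int p dvd int a ^ k - 1" for k
    by (metis cong_int_iff cong_iff_dvd_diff of_nat_1 of_nat_power)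
  have "ord p a dvd n" using an cong ord_divides by blast
  \<comment> \<open>\<open>ord\<close> is 0 when \<open>a\<close> and \<open>p\<close> are not
    coprime; this is excluded because 0 does not divide the positive \<open>n\<close>.\<close>
  moreover have "ord p a > 0" using calculation \<open>n > 0\<close> by (auto intro: Nat.gr0I)
  moreover have "\<not> ord p a < n" using ak[of "ord p a"] cong[of "ord p a"] ord[of a p] calculation by blast
  ultimately have "ord p a = n" using \<open>n > 0\<close> by (meson dvd_imp_le le_neq_implies_less)
  moreover have "coprime p a" using \<open>ord p a > 0\<close> by simp
  ultimately have "n dvd p - 1"
    using order_divides_totient[of p a] totient_prime[OF pa(1)] by simp
  then have "[p = 1] (mod n)"
    using prime_gt_0_nat[OF pa(1)] by (simp add: cong_altdef_nat)
  then show ?thesis using that pa(1) pT by blast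
qed

subsection \<open>Value sets of polynomials modulo primes\<close>

text \<open>Telescoping (x+1)^(i+1) - x^(i+1) over x < p yields p^(i+1). The binomial theorem then
  expresses i+1 times the i-th power sum through the lower ones, and i+1 < p is invertible modulo p.
  For i = 0 the convention 0^0 = 1 counts.\<close>

lemma prime_dvd_power_sum:
  fixes p i :: nat
  assumes "prime p" "i < p - 1"
  shows "int p dvd (\<Sum>x<p. int x ^ i)"
  using assms(2)
proof (induction i rule: less_induct)
  case (less i)
  have bin: "int (Suc x) ^ Suc i - int x ^ Suc i = (\<Sum>j\<le>i. int (Suc i choose j) * int x ^ j)" for x
  proof -
    have "int (Suc x) ^ Suc i = (\<Sum>j\<le>Suc i. int (Suc i choose j) * int x ^ j)"
      using binomial_ring[of "int x" 1 "Suc i"] by (simp add: add.commute)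
    then show ?thesis by (simp only: sum.atMost_Suc) simp
  qed
  have "int p ^ Suc i = (\<Sum>x<p. int (Suc x) ^ Suc i - int x ^ Suc i)"
    by (subst sum_lessThan_telescope) simp
  also have "\<dots> = (\<Sum>x<p. \<Sum>j\<le>i. int (Suc i choose j) * int x ^ j)"
    by (simp only: bin)
  also have "\<dots> = (\<Sum>j\<le>i. int (Suc i choose j) * (\<Sum>x<p. int x ^ j))"
    by (subst sum.swap) (simp add: sum_distrib_left)
  also have "\<dots> = (\<Sum>j<i. int (Suc i choose j) * (\<Sum>x<p. int x ^ j)) + int (Suc i) * (\<Sum>x<p. int x ^ i)"
    by (simp flip: lessThan_Suc_atMost)
  finally have eq: "int (Suc i) * (\<Sum>x<p. int x ^ i) = int p ^ Suc i - (\<Sum>j<i. int (Suc i choose j) * (\<Sum>x<p. int x ^ j))"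
    by simp
  have "int p dvd int p ^ Suc i - (\<Sum>j<i. int (Suc i choose j) * (\<Sum>x<p. int x ^ j))"
    using less by (intro dvd_diff dvd_sum[where f = "\<lambda>j. _ j * _ j"] dvd_mult) auto
  then have "int p dvd int (Suc i) * (\<Sum>x<p. int x ^ i)" unfolding eq .
  moreover have "\<not> int p dvd int (Suc i)"
    using less.prems by (auto simp: int_dvd_int_iff dest: dvd_imp_le simp del: of_nat_Suc)
  ultimately show ?case
    using \<open>prime p\<close> prime_dvd_mult_iff[of "int p"] by simp
qed

text \<open>By Fermat, each of the p - 1 terms with nonzero x is congruent to 1.\<close>

lemma power_sum_prime_minus_1:
  fixes p :: nat
  assumes "prime p"
  shows "[(\<Sum>x<p. int x ^ (p - 1)) = -1] (mod int p)"
proof -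
  have p1: "p - 1 > 0" using prime_gt_1_nat[OF assms] by simp
  have "(\<Sum>x<p. int x ^ (p - 1)) = (\<Sum>x\<in>{..<p} - {0}. int x ^ (p - 1))"
    using p1 by (intro sum.mono_neutral_right) auto
  also have "[\<dots> = (\<Sum>x\<in>{..<p} - {0}. 1)] (mod int p)"
  proof (rule cong_sum)
    fix x assume "x \<in> {..<p} - {0}"
    then have "\<not> p dvd x" by (auto dest: dvd_imp_le)
    then have "[x ^ (p - 1) = 1] (mod p)" using fermat_theorem assms by blast
    then show "[int x ^ (p - 1) = 1] (mod int p)"
      by (metis cong_int_iff of_nat_1 of_nat_power)
  qed
  also have "(\<Sum>x\<in>{..<p} - {0}. 1) = int p - 1"
    using p1 by (simp add: of_nat_diff)
  also have "[int p - 1 = -1] (mod int p)" by (simp add: cong_iff_dvd_diff)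
  finally show ?thesis .
qed

text \<open>Summing monomial by monomial, all power sums with exponent below p - 1 vanish modulo p,
  and the one with exponent p - 1 contributes -1.\<close>

lemma poly_sum_mod_prime:
  fixes p :: nat and G :: "int poly"
  assumes "prime p" "degree G \<le> p - 1"
  shows "[(\<Sum>x<p. poly G (int x)) = - coeff G (p - 1)] (mod int p)"
proof -
  have "(\<Sum>x<p. poly G (int x)) = (\<Sum>x<p. \<Sum>i\<le>p - 1. coeff G i * int x ^ i)"
    unfolding poly_altdef using assms(2)
    by (intro sum.cong refl sum.mono_neutral_left) (auto intro: coeff_eq_0)
  also have "\<dots> = (\<Sum>i\<le>p - 1. coeff G i * (\<Sum>x<p. int x ^ i))"
    by (subst sum.swap) (simp add: sum_distrib_left)
  also have "\<dots> = (\<Sum>i<p - 1. coeff G i * (\<Sum>x<p. int x ^ i)) + coeff G (p - 1) * (\<Sum>x<p. int x ^ (p - 1))"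
    by (simp flip: lessThan_Suc_atMost)
  also have "[\<dots> = 0 + coeff G (p - 1) * (-1)] (mod int p)"
    using assms(1) prime_dvd_power_sum
    by (intro cong_add cong_scalar_left power_sum_prime_minus_1)
       (auto simp: cong_0_iff intro!: dvd_sum[where f = "\<lambda>j. _ j * _ j"] dvd_mult)
  finally show ?thesis by simp
qed

section \<open>Residues attained by a polynomial\<close>

lemma poly_mod_cong: "[x = y] (mod m) \<Longrightarrow> [poly f x = poly f y] (mod m)" for x y m :: int
  by (induction f) (auto intro: cong_add cong_mult)

text \<open>With x ranging over all integers, passing to a divisor of the modulus and including the
  image of any subset of the integers are both immediate.\<close>

definition residue_image :: "int poly \<Rightarrow> nat \<Rightarrow> int set" where
  "residue_image f k = range (\<lambda>x. poly f x mod int k)"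

lemma residue_image_eq:
  assumes "k > 0"
  shows "residue_image f k = (\<lambda>x. poly f (int x) mod int k) ` {..<k}"
proof -
  have "poly f x mod int k \<in> (\<lambda>x. poly f (int x) mod int k) ` {..<k}" for x
  proof (rule image_eqI)
    show "poly f x mod int k = poly f (int (nat (x mod int k))) mod int k"
      using poly_mod_cong[of x "x mod int k" "int k" f] assms by (simp add: cong_def)
    show "nat (x mod int k) \<in> {..<k}" using assms by (simp add: nat_less_iff)
  qed
  then show ?thesis unfolding residue_image_def by auto
qed

lemma finite_residue_image: "k > 0 \<Longrightarrow> finite (residue_image f k)"
  by (simp add: residue_image_eq)

text \<open>Chinese remainder theorem: a residue modulo \<open>k * m\<close> is determined by its
  pair of reductions, each of which is attained.\<close>

lemma card_residue_image_mult:
  assumes "k > 0" "m > 0" "coprime k m"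
  shows "card (residue_image f (k * m)) \<le> card (residue_image f k) * card (residue_image f m)"
proof -
  define g where "g y = (y mod int k, y mod int m)" for y :: int
  have "inj_on g (residue_image f (k * m))"
  proof (rule inj_onI)
    fix x y assume xy: "x \<in> residue_image f (k * m)" "y \<in> residue_image f (k * m)" "g x = g y"
    then have "[x = y] (mod int k * int m)"
      using assms(3) by (intro coprime_cong_mult) (auto simp: g_def cong_def)
    then show "x = y" using xy(1,2) by (auto simp: residue_image_def cong_def)
  qed
  moreover have "g ` residue_image f (k * m) \<subseteq> residue_image f k \<times> residue_image f m"
    by (auto simp: g_def residue_image_def mod_mod_cancel)
  ultimately show ?thesis
    using card_inj_on_le[of g _ "residue_image f k \<times> residue_image f m"] assms
    by (simp add: card_cartesian_product finite_residue_image)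
qed

lemma card_residue_image_prime:
  fixes f :: "int poly" and p :: nat
  assumes "prime p" and d: "degree f \<ge> 2" and dvd: "degree f dvd p - 1"
    and lc: "\<not> int p dvd lead_coeff f"
  shows "p - 1 < 2 * degree f * (p - card (residue_image f p))"
proof (rule ccontr)
  assume "\<not> p - 1 < 2 * degree f * (p - card (residue_image f p))"
  moreover obtain u where u: "p - 1 = degree f * u" using dvd by (elim dvdE)
  \<comment> \<open>If the claim fails, twice the number of missed residues is at most
    \<open>u\<close>. The factor 2 leaves room for the missed values and for the repeated
    ones.\<close>
  ultimately have wu: "2 * (p - card (residue_image f p)) \<le> u" using d by simp
  have p0: "p > 0" and p1: "p > 1" using prime_gt_1_nat[OF assms(1)] by auto
  have "u > 0" using u p1 by (cases u) auto
  \<comment> \<open>Here degree at least 2 enters: a polynomial of degree \<open>u\<close> has no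
    coefficient at p - 1, so its sum over all residues vanishes modulo p.\<close>
  then have "u < p - 1" using u d by simp
  define X where "X = {..<p}"
  define \<phi> where "\<phi> x = nat (poly f (int x) mod int p)" for x
  have phi: "int (\<phi> x) = poly f (int x) mod int p" for x using p0 by (simp add: \<phi>_def)
  have "residue_image f p = int ` \<phi> ` X"
    by (simp add: residue_image_eq[OF p0] image_image phi X_def)
  then have card: "card (residue_image f p) = card (\<phi> ` X)"
    by (simp add: card_image)
  have sub: "\<phi> ` X \<subseteq> X" using p0 by (auto simp: \<phi>_def X_def nat_less_iff)
  \<comment> \<open>\<open>R\<close> contains exactly one preimage of each attained value.\<close>
  obtain R where R: "R \<subseteq> X" "inj_on \<phi> R" "\<phi> ` X = \<phi> ` R"
    using subset_image_inj[of "\<phi> ` X" \<phi> X] by auto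
  \<comment> \<open>off \<open>S\<close>, the map \<open>\<phi>\<close> is a bijection\<close>
  define S where "S = (X - \<phi> ` X) \<union> \<phi> ` (X - R)"
  have fin: "finite X" "finite S" by (auto simp: S_def X_def)
  have "card (X - \<phi> ` X) = p - card (\<phi> ` X)"
    using sub by (simp add: card_Diff_subset X_def)
  moreover have "card (X - R) = p - card (\<phi> ` X)"
    using R by (simp add: card_Diff_subset finite_subset[OF R(1) fin(1)] card_image)
      (simp add: X_def)
  then have "card (\<phi> ` (X - R)) \<le> p - card (\<phi> ` X)"
    using card_image_le[of "X - R" \<phi>] fin by simp
  ultimately have cS: "card S \<le> u"
    using wu card card_Un_le[of "X - \<phi> ` X" "\<phi> ` (X - R)"] unfolding S_def by linarith
  \<comment> \<open>A monic polynomial vanishing on \<open>S\<close>, padded by a power of the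
    variable to degree exactly \<open>u\<close>; composed with \<open>f\<close> it then has degree
    exactly p - 1.\<close>
  define g where "g = monom 1 (u - card S) * (\<Prod>s\<in>S. [:- int s, 1:])"
  have prod: "degree (\<Prod>s\<in>S. [:- int s, 1:]) = card S"
    by (subst degree_prod_eq_sum_degree) auto
  have nz: "(\<Prod>s\<in>S. [:- int s, 1:]) \<noteq> 0" using fin(2) by simp
  have dg: "degree g = u"
    unfolding g_def using nz cS by (subst degree_mult_eq) (simp_all add: degree_monom_eq prod)
  have lg: "lead_coeff g = 1"
    unfolding g_def by (simp add: lead_coeff_mult lead_coeff_prod degree_monom_eq)
  have g0: "poly g (int s) = 0" if "s \<in> S" for s
    unfolding g_def using that fin(2) by (auto simp: poly_prod prod_zero_iff)
  have dG: "degree (pcompose g f) = p - 1"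
    by (simp add: degree_pcompose dg u mult.commute del: One_nat_def)
  have lG: "coeff (pcompose g f) (p - 1) = lead_coeff f ^ u"
    using lead_coeff_comp[of f g] d lg by (simp add: dG dg)
  have "[(\<Sum>x\<in>X. poly (pcompose g f) (int x)) = - (lead_coeff f ^ u)] (mod int p)"
    using poly_sum_mod_prime[OF assms(1), of "pcompose g f"] unfolding X_def by (simp add: dG lG del: One_nat_def)
  moreover have "[(\<Sum>x\<in>X. poly (pcompose g f) (int x)) = 0] (mod int p)"
  proof -
    have "(\<Sum>x\<in>X. poly (pcompose g f) (int x)) = (\<Sum>x\<in>X. poly g (poly f (int x)))"
      by (simp add: poly_pcompose)
    also have "[\<dots> = (\<Sum>x\<in>X. poly g (int (\<phi> x)))] (mod int p)"
      by (intro cong_sum poly_mod_cong) (simp add: phi cong_def)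
    \<comment> \<open>Arguments outside \<open>R\<close> have their values in \<open>S\<close>,
      where \<open>g\<close> is 0.\<close>
    also have "(\<Sum>x\<in>X. poly g (int (\<phi> x))) = (\<Sum>x\<in>R. poly g (int (\<phi> x)))"
      using R(1) fin by (intro sum.mono_neutral_right) (auto simp: S_def intro!: g0)
    also have "\<dots> = (\<Sum>v\<in>\<phi> ` X. poly g (int v))"
      unfolding R(3) by (simp add: sum.reindex[OF R(2)])
    \<comment> \<open>The missed values also lie in \<open>S\<close>, so adding them changes
      nothing.\<close>
    also have "\<dots> = (\<Sum>v\<in>X. poly g (int v))"
      using sub fin by (intro sum.mono_neutral_left) (auto simp: S_def intro!: g0)
    also have "[\<dots> = 0] (mod int p)"
      using poly_sum_mod_prime[OF assms(1), of g] \<open>u < p - 1\<close>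
      by (simp add: X_def dg coeff_eq_0)
    finally show ?thesis .
  qed
  ultimately have "[- (lead_coeff f ^ u) = 0] (mod int p)"
    using cong_trans cong_sym by blast
  then have "int p dvd lead_coeff f ^ u" by (simp add: cong_0_iff)
  then show False using lc assms(1) prime_dvd_power[of "int p"] by auto
qed

lemma residue_image_ratio_prime:
  fixes f :: "int poly" and p :: nat
  assumes p: "prime p" and d: "degree f \<ge> 2" and cong: "[p = 1] (mod degree f)"
    and lc: "\<not> int p dvd lead_coeff f"
  shows "real (card (residue_image f p)) / real p \<le> 1 - 1 / (4 * real (degree f))"
proof -
  have p1: "p > 1" using prime_gt_1_nat[OF p] .
  have "degree f dvd p - 1" using cong p1 by (simp add: cong_altdef_nat)
  then have "p - 1 < 2 * degree f * (p - card (residue_image f p))"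
    using card_residue_image_prime p d lc by blast
  \<comment> \<open>Replacing p - 1 by p costs a factor 2, which turns the constant 2d into
    4d.\<close>
  moreover have "p \<le> 2 * (p - 1)" using p1 by simp
  ultimately have "p \<le> 4 * degree f * (p - card (residue_image f p))" by linarith
  moreover have le: "card (residue_image f p) \<le> p"
    using p1 card_image_le[of "{..<p}"] by (simp add: residue_image_eq)
  ultimately have "real p \<le> 4 * real (degree f) * (real p - real (card (residue_image f p)))"
    by (metis of_nat_diff of_nat_le_iff of_nat_mult of_nat_numeral)
  then show ?thesis using p1 d by (simp add: field_simps)
qed

lemma residue_image_ratio_power:
  fixes f :: "int poly"
  assumes d: "degree f \<ge> 2"
  shows "\<exists>k>0. real (card (residue_image f k)) / real k \<le> (1 - 1 / (4 * real (degree f))) ^ m"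
proof (induction m)
  case 0
  have "card (residue_image f 1) \<le> 1" using card_image_le[of "{..<1::nat}"] by (simp add: residue_image_eq)
  then show ?case by (intro exI[of _ 1]) simp
next
  case (Suc m)
  let ?c = "1 - 1 / (4 * real (degree f))"
  obtain k where k: "k > 0" "real (card (residue_image f k)) / real k \<le> ?c ^ m"
    using Suc.IH by blast
  have "f \<noteq> 0" using d by auto
  then have "k * nat \<bar>lead_coeff f\<bar> > 0" using k(1) by simp
  moreover have "degree f > 0" using d by simp
  \<comment> \<open>A prime not dividing \<open>k\<close> is coprime to the modulus built so far, so
    the ratios multiply.\<close>
  ultimately obtain p where p: "prime p" "[p = 1] (mod degree f)" "\<not> p dvd k * nat \<bar>lead_coeff f\<bar>"
    using prime_cong_1 by blast
  have pk: "\<not> p dvd k" and pl: "\<not> int p dvd lead_coeff f"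
    using p(3) by (auto simp: dvd_nat_abs_iff)
  have p0: "p > 0" using prime_gt_0_nat[OF p(1)] .
  have "coprime k p" using prime_imp_coprime[OF p(1) pk] by (simp add: coprime_commute)
  then have "real (card (residue_image f (k * p))) \<le> real (card (residue_image f k)) * real (card (residue_image f p))"
    using card_residue_image_mult[OF k(1) p0] by (metis of_nat_le_iff of_nat_mult)
  then have "real (card (residue_image f (k * p))) / real (k * p)
      \<le> (real (card (residue_image f k)) / real k) * (real (card (residue_image f p)) / real p)"
    using k(1) p0 by (simp add: divide_right_mono)
  also have "\<dots> \<le> ?c ^ m * ?c"
    using k(2) residue_image_ratio_prime[OF p(1) d p(2) pl] d
    by (intro mult_mono) (auto simp: field_simps)
  finally show ?case using k(1) p0 by (intro exI[of _ "k * p"]) (simp add: mult.commute)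
qed

lemma residue_image_ratio_less:
  fixes f :: "int poly"
  assumes "degree f \<ge> 2" "e > 0"
  obtains k where "k > 0" "real (card (residue_image f k)) / real k < e"
proof -
  have "0 \<le> 1 - 1 / (4 * real (degree f))" "1 - 1 / (4 * real (degree f)) < 1"
    using assms(1) by (auto simp: field_simps)
  then obtain m where "(1 - 1 / (4 * real (degree f))) ^ m < e"
    using real_arch_pow_inv assms(2) by blast
  then show ?thesis using residue_image_ratio_power[OF assms(1), of m] that by (meson le_less_trans)
qed

subsection \<open>Upper asymptotic density\<close>

text \<open>For a bounded sequence this is the limit superior, taken directly as a real
  infimum.\<close>

definition eventual_bound :: "(nat \<Rightarrow> real) \<Rightarrow> real" where
  "eventual_bound f = Inf {c. eventually (\<lambda>n. f n \<le> c) sequentially}"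

lemma eventual_bound_le:
  assumes "\<And>n. f n \<ge> 0" "eventually (\<lambda>n. f n \<le> c) sequentially"
  shows "eventual_bound f \<le> c"
  unfolding eventual_bound_def
proof (rule cInf_lower)
  show "bdd_below {c. eventually (\<lambda>n. f n \<le> c) sequentially}"
  proof (rule bdd_belowI)
    fix c assume "c \<in> {c. eventually (\<lambda>n. f n \<le> c) sequentially}"
    then obtain n where "f n \<le> c" by (auto simp: eventually_sequentially)
    then show "0 \<le> c" using assms(1)[of n] by simp
  qed
qed (use assms in simp)

text \<open>The uniform bound \<open>b\<close> makes the set of eventual bounds nonempty, so some
  element of it lies below \<open>c\<close>.\<close>

lemma eventually_le_eventual_bound:
  assumes "\<And>n. f n \<le> b" "eventual_bound f < c"
  shows "eventually (\<lambda>n. f n \<le> c) sequentially"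
proof -
  have ne: "{c. eventually (\<lambda>n. f n \<le> c) sequentially} \<noteq> {}"
    using assms(1) by (auto intro!: exI[of _ b])
  then obtain c' where "eventually (\<lambda>n. f n \<le> c') sequentially" "c' < c"
    using cInf_lessD[OF ne assms(2)[unfolded eventual_bound_def]] by auto
  then show ?thesis by (elim eventually_mono) simp
qed

lemma eventual_bound_leI:
  assumes "\<And>n. f n \<ge> 0"
    and "\<And>e. e > 0 \<Longrightarrow> eventually (\<lambda>n. f n \<le> c + e) sequentially"
  shows "eventual_bound f \<le> c"
  by (rule field_le_epsilon, rule eventual_bound_le) (use assms in auto)

text \<open>Only positive elements are counted, so a single density serves for both the integers and
  the naturals.\<close>

definition counting :: "int set \<Rightarrow> nat \<Rightarrow> nat" where
  "counting X n = card (X \<inter> {1..int n})"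

definition upper_density :: "int set \<Rightarrow> real" where
  "upper_density X = eventual_bound (\<lambda>n. real (counting X n) / real n)"

lemma counting_le: "counting X n \<le> n"
  unfolding counting_def using card_mono[of "{1..int n}" "X \<inter> {1..int n}"] by simp

lemma counting_Un: "counting (X \<union> Y) n \<le> counting X n + counting Y n"
  unfolding counting_def by (simp add: Int_Un_distrib2 card_Un_le)

text \<open>For integral x, k x lies between 1 and n exactly when x lies between 1 and
  \<open>n div k\<close>.\<close>

lemma counting_scale:
  assumes "k \<ge> 1"
  shows "counting {int k * x | x. x \<in> X} n = counting X (n div k)"
proof -
  have iff: "1 \<le> int k * x \<longleftrightarrow> 1 \<le> x" for x
    using assms by (metis int_one_le_iff_zero_less mult_pos_pos of_nat_0_less_iff
        zero_less_mult_pos less_le_trans zero_less_one)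
  have le: "int k * x \<le> int n \<longleftrightarrow> x \<le> int (n div k)" for x
  proof
    assume "int k * x \<le> int n"
    then have "int k * x div int k \<le> int n div int k" using assms by (intro zdiv_mono1) auto
    then show "x \<le> int (n div k)" using assms by (simp add: zdiv_int)
  next
    assume "x \<le> int (n div k)"
    then have "int k * x \<le> int (k * (n div k))" by (simp add: mult_left_mono)
    also have "\<dots> \<le> int n" by (subst of_nat_le_iff) (rule times_div_less_eq_dividend)
    finally show "int k * x \<le> int n" .
  qed
  have "{int k * x | x. x \<in> X} \<inter> {1..int n} = (\<lambda>x. int k * x) ` (X \<inter> {1..int (n div k)})"
    using iff le by auto
  moreover have "inj_on (\<lambda>x. int k * x) (X \<inter> {1..int (n div k)})"
    using assms by (auto intro: inj_onI)
  ultimately show ?thesis unfolding counting_def by (simp add: card_image)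
qed

text \<open>Elements entering from below land in 1..h, and elements pushed beyond n come from the
  last h integers up to n.\<close>

lemma counting_shift:
  "counting {x + int h | x. x \<in> X} n \<le> counting X n + h"
  "counting X n \<le> counting {x + int h | x. x \<in> X} n + h"
proof -
  have "{x + int h | x. x \<in> X} \<inter> {1..int n} \<subseteq> (\<lambda>x. x + int h) ` (X \<inter> {1..int n}) \<union> {1..int h}"
    by auto
  then have "card ({x + int h | x. x \<in> X} \<inter> {1..int n})
      \<le> card ((\<lambda>x. x + int h) ` (X \<inter> {1..int n}) \<union> {1..int h})"
    by (intro card_mono) auto
  also have "\<dots> \<le> card ((\<lambda>x. x + int h) ` (X \<inter> {1..int n})) + card {1..int h}"
    by (rule card_Un_le)
  also have "\<dots> = card (X \<inter> {1..int n}) + h" by (simp add: card_image)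
  finally show "counting {x + int h | x. x \<in> X} n \<le> counting X n + h"
    unfolding counting_def .
next
  have "X \<inter> {1..int n}
      \<subseteq> (\<lambda>x. x - int h) ` ({x + int h | x. x \<in> X} \<inter> {1..int n}) \<union> {int n - int h<..int n}"
  proof
    fix x assume x: "x \<in> X \<inter> {1..int n}"
    show "x \<in> (\<lambda>x. x - int h) ` ({x + int h | x. x \<in> X} \<inter> {1..int n}) \<union> {int n - int h<..int n}"
    proof (cases "x + int h \<le> int n")
      case True
      then have "x + int h \<in> {x + int h | x. x \<in> X} \<inter> {1..int n}" using x by auto
      then show ?thesis by (intro UnI1 image_eqI[of _ _ "x + int h"]) auto
    qed (use x in auto)
  qed
  then have "card (X \<inter> {1..int n})
      \<le> card ((\<lambda>x. x - int h) ` ({x + int h | x. x \<in> X} \<inter> {1..int n}) \<union> {int n - int h<..int n})"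
    by (intro card_mono) auto
  also have "\<dots> \<le> card ((\<lambda>x. x - int h) ` ({x + int h | x. x \<in> X} \<inter> {1..int n})) + card {int n - int h<..int n}"
    by (rule card_Un_le)
  also have "\<dots> = card ({x + int h | x. x \<in> X} \<inter> {1..int n}) + h" by (simp add: card_image)
  finally show "counting X n \<le> counting {x + int h | x. x \<in> X} n + h"
    unfolding counting_def .
qed

lemma upper_density_le_1_seq: "real (counting X n) / real n \<le> 1"
  using counting_le[of X n] by (cases "n = 0") (simp_all add: divide_le_eq_1)

lemma upper_density_leI:
  assumes "\<And>e. e > 0 \<Longrightarrow> eventually (\<lambda>n. real (counting X n) / real n \<le> c + e) sequentially"
  shows "upper_density X \<le> c"
  unfolding upper_density_def using assms by (intro eventual_bound_leI) auto

lemma upper_densityD: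
  assumes "e > 0"
  shows "eventually (\<lambda>n. real (counting X n) / real n \<le> upper_density X + e) sequentially"
  unfolding upper_density_def using assms upper_density_le_1_seq
  by (intro eventually_le_eventual_bound[where b = 1]) auto

text \<open>A constant excess \<open>h\<close> contributes h/n, which tends to 0.\<close>

lemma upper_density_le_almost:
  assumes "\<And>n. counting X n \<le> counting Y n + h"
  shows "upper_density X \<le> upper_density Y"
proof (rule upper_density_leI)
  fix e :: real assume e: "e > 0"
  have "(\<lambda>n. real h / real n) \<longlonglongrightarrow> 0" by (rule lim_const_over_n)
  then have "eventually (\<lambda>n. real h / real n < e / 2) sequentially"
    using e by (intro order_tendstoD) auto
  moreover have "eventually (\<lambda>n. real (counting Y n) / real n \<le> upper_density Y + e / 2) sequentially"
    using e by (intro upper_densityD) auto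
  ultimately show "eventually (\<lambda>n. real (counting X n) / real n \<le> upper_density Y + e) sequentially"
  proof eventually_elim
    case (elim n)
    have "real (counting X n) \<le> real (counting Y n) + real h" using assms[of n] by linarith
    then have "real (counting X n) / real n \<le> real (counting Y n) / real n + real h / real n"
      by (simp add: divide_right_mono flip: add_divide_distrib)
    then show ?case using elim by linarith
  qed
qed

lemma upper_density_scale:
  assumes "k \<ge> 1"
  shows "upper_density {int k * x | x. x \<in> X} = 1 / real k * upper_density X"
proof (rule antisym)
  show "upper_density {int k * x | x. x \<in> X} \<le> 1 / real k * upper_density X"
  proof (rule upper_density_leI)
    fix e :: real assume "e > 0"
    \<comment> \<open>The tolerance is \<open>k * e\<close> because the estimate is divided by
      \<open>k\<close> later; it is used at m = \<open>n div k\<close>, where k m \<le> n.\<close>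
    then have "eventually (\<lambda>m. real (counting X m) / real m \<le> upper_density X + k * e) sequentially"
      using assms by (intro upper_densityD) auto
    moreover have "filterlim (\<lambda>n. n div k) at_top sequentially"
      using assms by (intro filterlim_at_top_div_const_nat) auto
    ultimately have "eventually (\<lambda>n. real (counting X (n div k)) / real (n div k) \<le> upper_density X + k * e) sequentially"
      by (rule eventually_compose_filterlim)
    then show "eventually (\<lambda>n. real (counting {int k * x | x. x \<in> X} n) / real n
        \<le> 1 / real k * upper_density X + e) sequentially"
      using eventually_ge_at_top[of k]
    proof eventually_elim
      case (elim n)
      have "n div k > 0" using elim assms by (simp add: div_greater_zero_iff)
      have "real (counting X (n div k)) / real n \<le> real (counting X (n div k)) / (real k * real (n div k))"
        using \<open>n div k > 0\<close> assms elim
        by (intro divide_left_mono) (auto simp flip: of_nat_mult intro!: mult_pos_pos)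
      also have "\<dots> = (real (counting X (n div k)) / real (n div k)) / real k" by simp
      also have "\<dots> \<le> (upper_density X + k * e) / real k"
        using elim by (intro divide_right_mono) auto
      also have "\<dots> = 1 / real k * upper_density X + e" using assms by (simp add: field_simps)
      finally show ?case by (simp add: counting_scale[OF assms])
    qed
  qed
  \<comment> \<open>For the converse it suffices to look at multiples of \<open>k\<close>, where the
    division is exact.\<close>
  have "upper_density X \<le> real k * upper_density {int k * x | x. x \<in> X}"
  proof (rule upper_density_leI)
    fix e :: real assume "e > 0"
    then have "eventually (\<lambda>n. real (counting {int k * x | x. x \<in> X} n) / real n
        \<le> upper_density {int k * x | x. x \<in> X} + e / k) sequentially"
      using assms by (intro upper_densityD) auto
    moreover have "filterlim (\<lambda>n. k * n) at_top sequentially"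
      using assms by (intro mult_nat_left_at_top) auto
    ultimately have "eventually (\<lambda>n. real (counting {int k * x | x. x \<in> X} (k * n)) / real (k * n)
        \<le> upper_density {int k * x | x. x \<in> X} + e / k) sequentially"
      by (rule eventually_compose_filterlim)
    then show "eventually (\<lambda>n. real (counting X n) / real n
        \<le> real k * upper_density {int k * x | x. x \<in> X} + e) sequentially"
    proof eventually_elim
      case (elim n)
      have "real (counting X n) / real n = k * (real (counting {int k * x | x. x \<in> X} (k * n)) / real (k * n))"
        using assms by (simp add: counting_scale[OF assms])
      also have "\<dots> \<le> k * (upper_density {int k * x | x. x \<in> X} + e / k)"
        using elim by (intro mult_left_mono) auto
      also have "\<dots> = k * upper_density {int k * x | x. x \<in> X} + e"
        using assms by (simp add: field_simps)
      finally show ?case .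
    qed
  qed
  then show "1 / real k * upper_density X \<le> upper_density {int k * x | x. x \<in> X}"
    using assms by (simp add: field_simps)
qed

lemma upper_density_Un: "upper_density (X \<union> Y) \<le> upper_density X + upper_density Y"
proof (rule upper_density_leI)
  fix e :: real assume "e > 0"
  then have "e / 2 > 0" by simp
  from upper_densityD[OF this, of X] upper_densityD[OF this, of Y]
  show "eventually (\<lambda>n. real (counting (X \<union> Y) n) / real n \<le> upper_density X + upper_density Y + e) sequentially"
  proof eventually_elim
    case (elim n)
    have "real (counting (X \<union> Y) n) \<le> real (counting X n) + real (counting Y n)"
      using counting_Un[of X Y n] by linarith
    then have "real (counting (X \<union> Y) n) / real n \<le> real (counting X n) / real n + real (counting Y n) / real n"
      by (simp add: divide_right_mono flip: add_divide_distrib)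
    then show ?case using elim by linarith
  qed
qed

lemma upper_density_eq_1:
  assumes "{0<..} \<subseteq> H"
  shows "upper_density H = 1"
proof (rule antisym)
  show "upper_density H \<le> 1"
    unfolding upper_density_def by (intro eventual_bound_le) (auto simp: upper_density_le_1_seq)
  show "1 \<le> upper_density H"
  proof (rule field_le_epsilon)
    fix e :: real assume "e > 0"
    then have "eventually (\<lambda>n. real (counting H n) / real n \<le> upper_density H + e) sequentially"
      by (rule upper_densityD)
    then obtain n where "n > 0" "real (counting H n) / real n \<le> upper_density H + e"
      unfolding eventually_sequentially by (metis le_add2 le_add1 zero_less_one less_le_trans)
    moreover have "H \<inter> {1..int n} = {1..int n}" using assms by auto
    then have "counting H n = n" by (simp add: counting_def)
    ultimately show "1 \<le> upper_density H + e" by simp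
  qed
qed

lemma upper_quasi_density_upper_density:
  assumes "{0<..} \<subseteq> H"
  shows "upper_quasi_density H upper_density"
proof -
  have "upper_density X \<le> 1" for X
    unfolding upper_density_def by (rule eventual_bound_le) (auto simp: upper_density_le_1_seq)
  moreover have "upper_density {x + int h | x. x \<in> X} = upper_density X" for X h
    by (rule antisym; rule upper_density_le_almost; rule counting_shift)
  ultimately show ?thesis
    unfolding upper_quasi_density_def
    using upper_density_eq_1[OF assms] upper_density_Un upper_density_scale by blast
qed

subsection \<open>Upper quasi-densities\<close>

text \<open>Subadditivity is applied to \<open>X\<close> and itself.\<close>

lemma upper_quasi_density_nonneg:
  assumes "upper_quasi_density H \<mu>" "X \<subseteq> H"
  shows "\<mu> X \<ge> 0"
proof -
  have "\<mu> (X \<union> X) \<le> \<mu> X + \<mu> X" using assms unfolding upper_quasi_density_def by blast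
  then show ?thesis by simp
qed

lemma upper_quasi_density_scale:
  assumes "upper_quasi_density H \<mu>" "X \<subseteq> H" "k \<ge> 1"
  shows "\<mu> {int k * x | x. x \<in> X} = 1 / real k * \<mu> X"
  using assms unfolding upper_quasi_density_def by blast

lemma upper_quasi_density_shift:
  assumes "upper_quasi_density H \<mu>" "X \<subseteq> H"
  shows "\<mu> {x + int h | x. x \<in> X} = \<mu> X"
  using assms unfolding upper_quasi_density_def by blast

text \<open>The empty set equals its own double, so its value equals half of itself.\<close>

lemma upper_quasi_density_empty:
  assumes "upper_quasi_density H \<mu>"
  shows "\<mu> {} = 0"
  using upper_quasi_density_scale[OF assms, of "{}" 2] by simp

lemma upper_quasi_density_UN_le:
  assumes \<mu>: "upper_quasi_density H \<mu>" and "finite A" "\<And>a. a \<in> A \<Longrightarrow> X a \<subseteq> H"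
  shows "\<mu> (\<Union>a\<in>A. X a) \<le> (\<Sum>a\<in>A. \<mu> (X a))"
  using assms(2,3)
proof (induction A)
  case empty
  then show ?case by (simp add: upper_quasi_density_empty[OF \<mu>])
next
  case (insert a A)
  have "X a \<subseteq> H" "(\<Union>a\<in>A. X a) \<subseteq> H" using insert.prems by auto
  then have "\<mu> (X a \<union> (\<Union>a\<in>A. X a)) \<le> \<mu> (X a) + \<mu> (\<Union>a\<in>A. X a)"
    using \<mu> unfolding upper_quasi_density_def by blast
  then show ?case using insert by simp
qed

text \<open>Keeps the set of quotients of a residue class inside \<open>H\<close>, where the axioms
  apply. Over the naturals, a negative x would give k x + a \<le> a - k < 0.\<close>

lemma residue_quotient_mem:
  fixes k :: nat
  assumes "H = \<int> \<or> H = \<nat>" "0 \<le> a" "a < int k" "int k * x + a \<in> H"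
  shows "x \<in> H"
proof -
  have "x \<ge> 0" if "int k * x + a \<ge> 0"
  proof (rule ccontr)
    assume "\<not> x \<ge> 0"
    then have "int k * x \<le> int k * (- 1)" by (intro mult_left_mono) auto
    then show False using that assms(3) by simp
  qed
  then show ?thesis using assms(1,4) by (auto simp: Nats_altdef2 Ints_def)
qed

text \<open>Each residue class \<open>P a\<close> of \<open>X\<close> has the form k Y + a with
  \<open>Y\<close> inside \<open>H\<close>, so its value is at most 1/k. As \<open>X\<close> is
  exactly the union of the classes it meets, subadditivity suffices.\<close>

lemma upper_quasi_density_le_residues:
  assumes H: "H = \<int> \<or> H = \<nat>" and \<mu>: "upper_quasi_density H \<mu>"
    and X: "X \<subseteq> H" and k: "k > (0::nat)"
  shows "\<mu> X \<le> real (card ((\<lambda>x. x mod int k) ` X)) / real k"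
proof -
  define R where "R = (\<lambda>x. x mod int k) ` X"
  have "R \<subseteq> {0..<int k}" unfolding R_def using k by auto
  then have fin: "finite R" by (rule finite_subset) simp
  define P where "P a = {x \<in> X. x mod int k = a}" for a
  have P_le: "\<mu> (P a) \<le> 1 / real k" if "a \<in> R" for a
  proof -
    have a: "0 \<le> a" "a < int k" using that \<open>R \<subseteq> _\<close> by auto
    define Y where "Y = {x. int k * x + a \<in> X}"
    have Y: "Y \<subseteq> H" unfolding Y_def using residue_quotient_mem[OF H a] X by blast
    define Z where "Z = {int k * x | x. x \<in> Y}"
    have Z: "Z \<subseteq> H"
      unfolding Z_def using Y H by (auto simp: Nats_altdef2 Ints_def subset_iff)
    have "P a = {z + int (nat a) | z. z \<in> Z}"
    proof (intro Set.set_eqI iffI)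
      fix x assume "x \<in> P a"
      then have x: "x = int k * (x div int k) + a" "x \<in> X" by (auto simp: P_def)
      then have "int k * (x div int k) \<in> Z" unfolding Z_def Y_def by force
      then show "x \<in> {z + int (nat a) | z. z \<in> Z}" using x(1) a(1) by (auto intro!: exI[of _ "int k * (x div int k)"])
    next
      fix x assume "x \<in> {z + int (nat a) | z. z \<in> Z}"
      then show "x \<in> P a" using a by (auto simp: Z_def Y_def P_def)
    qed
    then have "\<mu> (P a) = \<mu> Z"
      by (simp only: upper_quasi_density_shift[OF \<mu> Z])
    also have "\<dots> = 1 / real k * \<mu> Y"
      unfolding Z_def using k by (intro upper_quasi_density_scale[OF \<mu> Y]) simp
    also have "\<dots> \<le> 1 / real k * 1"
      using \<mu> Y unfolding upper_quasi_density_def by (intro mult_left_mono) auto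
    finally show ?thesis by simp
  qed
  have "X = (\<Union>a\<in>R. P a)" by (auto simp: R_def P_def)
  then have "\<mu> X \<le> (\<Sum>a\<in>R. \<mu> (P a))"
    using upper_quasi_density_UN_le[OF \<mu> fin, of P] X by (auto simp: P_def)
  also have "\<dots> \<le> (\<Sum>a\<in>R. 1 / real k)" using P_le by (rule sum_mono)
  finally show ?thesis by (simp add: R_def)
qed

text \<open>The set {0} is its own double and so has value 0. Shifts carry {0} up to a positive
  \<open>c\<close>, or a negative \<open>c\<close> up to 0.\<close>

lemma upper_quasi_density_singleton:
  assumes H: "H = \<int> \<or> H = \<nat>" and \<mu>: "upper_quasi_density H \<mu>" and "c \<in> H"
  shows "\<mu> {c} = 0"
proof -
  have zero: "\<mu> {0} = 0"
    using upper_quasi_density_scale[OF \<mu>, of "{0}" 2] H by auto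
  show ?thesis
  proof (cases "c \<ge> 0")
    case True
    then show ?thesis using upper_quasi_density_shift[OF \<mu>, of "{0}" "nat c"] zero H by auto
  next
    case False
    then show ?thesis
      using upper_quasi_density_shift[OF \<mu>, of "{c}" "nat (- c)"] zero \<open>c \<in> H\<close> by simp
  qed
qed

section \<open>Polynomial images, by degree\<close>

lemma poly_image_subset:
  assumes "H = \<int> \<or> H = \<nat>" "\<forall>i. coeff p i \<in> H"
  shows "poly p ` H \<subseteq> (H :: int set)"
  using assms by (auto simp: poly_altdef Nats_altdef2 Ints_def intro!: sum_nonneg)

theorem theorem3p9:
  fixes H :: "int set" and F :: "int \<Rightarrow> int" and p :: "int poly"
  assumes "H = \<int> \<or> H = \<nat>"
    and "F = poly p"
    and "\<forall>i. coeff p i \<in> H"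
  shows "small_set H (F ` H) \<longleftrightarrow> degree p \<noteq> 1"
proof -
  have sub: "F ` H \<subseteq> H" using poly_image_subset assms by blast
  have "0 \<in> H" using assms(1) by auto
  consider "degree p = 0" | "degree p = 1" | "degree p \<ge> 2" by linarith
  then show ?thesis
  proof cases
    case 1
    then obtain c where p: "p = [:c:]" by (auto elim: degree_eq_zeroE)
    then have im: "F ` H = {c}" using assms(2) \<open>0 \<in> H\<close> by auto
    then have "c \<in> H" using sub by simp
    then show ?thesis
      using 1 im upper_quasi_density_singleton[OF assms(1)] by (simp add: small_set_def)
  next
    case 2
    then obtain a b where p: "p = [:b, a:]" and "a \<noteq> 0"
      by (metis degree_eq_zeroE degree_pCons_eq_if One_nat_def nat.inject nat.distinct(1) pCons_cases pCons_eq_0_iff)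
    have F: "F x = a * x + b" for x by (simp add: assms(2) p)
    define k where "k = nat \<bar>a\<bar>"
    have k: "k \<ge> 1" "int k = \<bar>a\<bar>" using \<open>a \<noteq> 0\<close> by (auto simp: k_def)
    \<comment> \<open>The axioms dilate and shift by natural numbers only, so the progression must
      be written with the positive factor |a| and a nonnegative offset.\<close>
    have "\<exists>h::nat. F ` H = {x + int h | x. x \<in> {int k * x | x. x \<in> H}}"
    proof (cases "H = \<nat>")
      case True
      have "coeff p 0 \<ge> 0" "coeff p 1 \<ge> 0" using assms(3) True by (auto simp: Nats_altdef2)
      then have "a \<ge> 0" "b \<ge> 0" by (auto simp: p)
      then show ?thesis using k(2) by (intro exI[of _ "nat b"]) (auto simp: F image_iff)
    next
      case False
      then have H: "H = UNIV" using assms(1) by (auto simp: Ints_def)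
      \<comment> \<open>Over the integers, \<open>b\<close> may be replaced by its residue modulo
        \<open>k\<close>; this and the sign of \<open>a\<close> amount to a bijective change of the
        argument.\<close>
      define h where "h = nat (b mod int k)"
      have h: "int h = b - int k * (b div int k)"
        using k(1) by (simp add: h_def minus_mult_div_eq_mod)
      have ak: "a = int k * sgn a" "int k = a * sgn a" using k(2) by (auto simp: abs_mult_sgn abs_sgn)
      have "F x = int k * (sgn a * x + b div int k) + int h" for x
        unfolding F h by (subst ak(1)) (simp add: algebra_simps)
      moreover have "int k * x + int h = F (sgn a * (x - b div int k))" for x
        unfolding F h by (simp add: ak(2) algebra_simps)
      ultimately have "range F = range (\<lambda>x. int k * x + int h)"
        unfolding image_def by (intro Collect_cong) (metis UNIV_I)
      then show ?thesis unfolding H by (intro exI[of _ h]) auto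
    qed
    then obtain h :: nat where im: "F ` H = {x + int h | x. x \<in> {int k * x | x. x \<in> H}}"
      by blast
    have "{0<..} \<subseteq> H" using assms(1) by (auto simp: Nats_altdef2 Ints_def)
    then have \<mu>: "upper_quasi_density H upper_density"
      by (rule upper_quasi_density_upper_density)
    have "{int k * x | x. x \<in> H} \<subseteq> H"
      using assms(1) by (auto simp: Nats_altdef2 Ints_def)
    \<comment> \<open>Shift and dilation give the image density 1/k, so this one quasi-density
      already shows that it is not small.\<close>
    then have "upper_density (F ` H) = 1 / real k * upper_density H"
      unfolding im by (simp only: upper_quasi_density_shift[OF \<mu>]
          upper_quasi_density_scale[OF \<mu> subset_refl k(1)])
    also have "\<dots> \<noteq> 0" using \<mu> k(1) by (simp add: upper_quasi_density_def)
    finally have "\<not> small_set H (F ` H)" using \<mu> by (auto simp: small_set_def)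
    then show ?thesis using 2 by simp
  next
    case 3
    have "\<mu> (F ` H) = 0" if \<mu>: "upper_quasi_density H \<mu>" for \<mu>
    proof (rule antisym)
      \<comment> \<open>The image meets only residues in \<open>residue_image p k\<close>, whose
        proportion falls below any \<open>e\<close> for suitable \<open>k\<close>.\<close>
      show "\<mu> (F ` H) \<le> 0"
      proof (rule field_le_epsilon)
        fix e :: real assume "e > 0"
        then obtain k where k: "k > 0" "real (card (residue_image p k)) / real k < e"
          using residue_image_ratio_less 3 by blast
        have "(\<lambda>x. x mod int k) ` F ` H \<subseteq> residue_image p k"
          unfolding residue_image_def assms(2) by auto
        then have "card ((\<lambda>x. x mod int k) ` F ` H) \<le> card (residue_image p k)"
          using finite_residue_image[OF k(1)] by (rule card_mono[rotated])
        then have "real (card ((\<lambda>x. x mod int k) ` F ` H)) / real k \<le> real (card (residue_image p k)) / real k"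
          by (intro divide_right_mono) auto
        then show "\<mu> (F ` H) \<le> 0 + e"
          using upper_quasi_density_le_residues[OF assms(1) \<mu> sub k(1)] k(2) by linarith
      qed
    qed (rule upper_quasi_density_nonneg[OF \<mu> sub])
    then show ?thesis using 3 sub by (simp add: small_set_def)
  qed
qed

end
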